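(* Let $p$ be an odd prime. For $k=0$ (so $r=s\ge1$), the $p^{(0)}$-Fibonacci numbers are $$\mathcal M_{1,0}(0)=\frac{p-1}{2},\qquad \mathcal M_{s,0}(0)=\frac{p-1}{2}\Big(2(s-1)p^{s-1}-(2s-3)p^{s-2}\Big)\quad\text{for all } s\ge 2,$$ where $\mathcal M_{s,0}(0)=\mathcal M\big(\lambda(2s;(x_{(2s,0)},x_{(s,0)}))\big)$.
   Context: Notation: $p$ is an odd prime, $k\ge0$, $r\ge1$ integers with $s=r-k\ge1$, $0\le l<p^k$; $x_{(a,k)}=p^k(ap-(a+1))$ for $a\ge1$. $\lambda(c;(n,i))$ denotes the hook partition $(n-i,1^i)$ of $n$, regarded as a vertex on floor $c$ of the $p$-Bratteli diagram. Paths. $P^{2r}_l$ is the set of all downward paths in the diagram from $\lambda(2r;(x_{(2s,k)},x_{(s,k)}+l))$ to floor $1$. Along a path, blocks $B(i;(m_i,n_i))$ ($m_i$ horizontal nodes and $n_i$ vertical nodes) are removed for $i=2r-1,2r-2,\dots,1$. Explicitly, a path $P$ is determined by arbitrary integers $u_s,u_{s-1},\dots,u_2\in\{0,\dots,p-1\}$ and $u_1\in\{0,\dots,p-2\}$ (distinct choices give distinct paths, and all paths arise). Put $L_s=l$ and, for $j=s,s-1,\dots,2$, $L'_j=L_j+p^ku_j$ and $L_{j-1}=\lfloor L'_j/p\rfloor$. The path visits $\lambda(2(k+j);(x_{(2j,k)},x_{(j,k)}+L_j))$ for $1\le j\le s$, $\lambda(2(k+j)-1;(x_{(2j-1,k)},x_{(j-1,k)}+L'_j))$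 for $2\le j\le s$, and $\lambda(2k+1;(p^k(p-1),L_1+p^ku_1))$; below floor $2k+1$ the path is forced. The blocks are, for $2\le j\le s$, $$m_{2(k+j)-1}=p^ku_j,\quad n_{2(k+j)-1}=p^k(p-1-u_j),\quad n_{2(k+j)-2}=L'_j-\lfloor L'_j/p\rfloor,\quad m_{2(k+j)-2}=p^k(p-1)-n_{2(k+j)-2},$$ and $m_{2k+1}=p^ku_1$, $n_{2k+1}=p^k(p-2-u_1)$. Descents. For $2k+2\le i\le 2r-2$, $P$ has a descent at block $i$ if $m_i>m_{i+1}$ and $n_i<n_{i+1}$ (these blocks all have size $m_i+n_i=p^k(p-1)$). By convention $P$ has a descent at block $2k$ if and only if $u_1<\frac{p-1}{2}$, it has no descent at block $2k+1$, and none at blocks below $2k$. $\mathrm{des}(P)$ is the number of descents of $P$. The $p^{(k)}$-Fibonacci number of the vertex is $$\mathcal M_{s,k}(l):=\mathcal M\big(\lambda(2r;(x_{(2s,k)},x_{(s,k)}+l))\big)=\sum_{P\in P^{2r}_l}\mathrm{des}(P).$$ *)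

theory Defs
  imports Complex_Main "HOL-Library.FuncSet" "HOL-Computational_Algebra.Primes"
begin

text \<open>
  Throughout, \<open>p\<close> is an odd prime, \<open>k \<ge> 0\<close>, \<open>s \<ge> 1\<close>, \<open>r = k + s\<close> and \<open>0 \<le> l < p ^ k\<close>.
  The hook partition \<open>(n - i, 1\<^sup>i)\<close> of \<open>n\<close> is represented by the pair \<open>(n, i)\<close>.  The coordinates
  are integers, so that no subtraction below is truncated.
\<close>

definition hook_x :: "nat \<Rightarrow> nat \<Rightarrow> nat \<Rightarrow> int" where
  "hook_x p k a = int p ^ k * (int a * int p - (int a + 1))"

text \<open>
  A choice of \<open>u\<^sub>s, \<dots>, u\<^sub>2 \<in> {0, \<dots>, p - 1}\<close> and \<open>u\<^sub>1 \<in> {0, \<dots>, p - 2}\<close>.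
\<close>

definition path_choices :: "nat \<Rightarrow> nat \<Rightarrow> (nat \<Rightarrow> nat) set" where
  "path_choices p s = (\<Pi>\<^sub>E j\<in>{1..s}. if j = 1 then {0..p - 2} else {0..p - 1})"

text \<open>
  \<open>path_L_down p k s l u d\<close> is \<open>L\<close> at index \<open>s - d\<close>: the recursion for \<open>L\<close> runs downwards from \<open>s\<close>.
\<close>

fun path_L_down :: "nat \<Rightarrow> nat \<Rightarrow> nat \<Rightarrow> nat \<Rightarrow> (nat \<Rightarrow> nat) \<Rightarrow> nat \<Rightarrow> nat" where
  "path_L_down p k s l u 0 = l"
| "path_L_down p k s l u (Suc d) = (path_L_down p k s l u d + p ^ k * u (s - d)) div p"

definition path_L :: "nat \<Rightarrow> nat \<Rightarrow> nat \<Rightarrow> nat \<Rightarrow> (nat \<Rightarrow> nat) \<Rightarrow> nat \<Rightarrow> nat" where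
  "path_L p k s l u j = path_L_down p k s l u (s - j)"

definition path_L' :: "nat \<Rightarrow> nat \<Rightarrow> nat \<Rightarrow> nat \<Rightarrow> (nat \<Rightarrow> nat) \<Rightarrow> nat \<Rightarrow> nat" where
  "path_L' p k s l u j = path_L p k s l u j + p ^ k * u j"

text \<open>
  The vertex on floor \<open>c\<close>.  Even floors are \<open>c = 2 * (k + j)\<close> and odd floors above \<open>2 * k + 1\<close> are
  \<open>c = 2 * (k + j) - 1\<close> with \<open>j \<ge> 2\<close>; hence \<open>j = (c + 1) div 2 - k\<close> in both cases.
\<close>

definition path_vertex ::
    "nat \<Rightarrow> nat \<Rightarrow> nat \<Rightarrow> nat \<Rightarrow> (nat \<Rightarrow> nat) \<Rightarrow> nat \<Rightarrow> int \<times> int" where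
  "path_vertex p k s l u c =
    (let j = (c + 1) div 2 - k in
      if c = 2 * k + 1 then
        (int p ^ k * (int p - 1), int (path_L p k s l u 1) + int p ^ k * int (u 1))
      else if even c then
        (hook_x p k (2 * j), hook_x p k j + int (path_L p k s l u j))
      else
        (hook_x p k (2 * j - 1), hook_x p k (j - 1) + int (path_L' p k s l u j)))"

text \<open>
  A path is its sequence of vertices, indexed by the floor.  It is recorded on the floors
  \<open>2 * k + 1, \<dots>, 2 * (k + s)\<close> only: below floor \<open>2 * k + 1\<close> it is forced, and it has no descents
  at the blocks below \<open>2 * k\<close>.  For \<open>k = 0\<close> these are all the floors from \<open>1\<close> to \<open>2 * s\<close>.
\<close>

type_synonym hook_path = "nat \<Rightarrow> int \<times> int"

definition path_of :: "nat \<Rightarrow> nat \<Rightarrow> nat \<Rightarrow> nat \<Rightarrow> (nat \<Rightarrow> nat) \<Rightarrow> hook_path" where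
  "path_of p k s l u = restrict (path_vertex p k s l u) {2 * k + 1..2 * (k + s)}"

definition paths :: "nat \<Rightarrow> nat \<Rightarrow> nat \<Rightarrow> nat \<Rightarrow> hook_path set" where
  "paths p k s l = path_of p k s l ` path_choices p s"

text \<open>
  Block \<open>i\<close> is removed between floor \<open>i + 1\<close> and floor \<open>i\<close>.  The hook \<open>(n - i, 1\<^sup>i)\<close> has \<open>i\<close> nodes in
  its leg and \<open>n - i\<close> nodes in its first row, so the vertical nodes of the block are counted by the
  difference of the legs and its horizontal nodes by the difference of the first rows.
\<close>

definition block_v :: "hook_path \<Rightarrow> nat \<Rightarrow> int" where
  "block_v P i = snd (P (i + 1)) - snd (P i)"

definition block_h :: "hook_path \<Rightarrow> nat \<Rightarrow> int" where
  "block_h P i = (fst (P (i + 1)) - snd (P (i + 1))) - (fst (P i) - snd (P i))"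

text \<open>
  Since the block \<open>2 * k + 1\<close> has \<open>p ^ k * u 1\<close> horizontal nodes (see \<open>block_h_bottom\<close> below), the
  second disjunct is the convention that there is a descent at block \<open>2 * k\<close> iff
  \<open>u\<^sub>1 < (p - 1) / 2\<close>.
\<close>

definition has_descent :: "nat \<Rightarrow> nat \<Rightarrow> nat \<Rightarrow> hook_path \<Rightarrow> nat \<Rightarrow> bool" where
  "has_descent p k s P i \<longleftrightarrow>
     (2 * k + 2 \<le> i \<and> i \<le> 2 * (k + s) - 2 \<and>
        block_h P i > block_h P (i + 1) \<and> block_v P i < block_v P (i + 1)) \<or>
     (i = 2 * k \<and> real_of_int (block_h P (2 * k + 1) div int p ^ k) < (real p - 1) / 2)"

definition des :: "nat \<Rightarrow> nat \<Rightarrow> nat \<Rightarrow> hook_path \<Rightarrow> nat" where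
  "des p k s P = card {i. has_descent p k s P i}"

definition fibonacci_number :: "nat \<Rightarrow> nat \<Rightarrow> nat \<Rightarrow> nat \<Rightarrow> nat" where
  "fibonacci_number p s k l = (\<Sum>P\<in>paths p k s l. des p k s P)"

subsection \<open>Consistency of the encoding\<close>

lemma path_L_top [simp]: "path_L p k s l u s = l"
  by (simp add: path_L_def)

lemma path_L_step:
  assumes "2 \<le> j" "j \<le> s"
  shows "path_L p k s l u (j - 1) = path_L' p k s l u j div p"
proof -
  have "s - (j - 1) = Suc (s - j)" "s - (s - j) = j"
    using assms by auto
  then show ?thesis
    by (simp add: path_L_def path_L'_def)
qed

lemma path_of_even:
  assumes "1 \<le> j" "j \<le> s"
  shows "path_of p k s l u (2 * (k + j)) =
    (hook_x p k (2 * j), hook_x p k j + int (path_L p k s l u j))"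
proof -
  have "(2 * (k + j) + 1) div 2 - k = j" "2 * (k + j) \<noteq> 2 * k + 1"
    by presburger+
  then show ?thesis
    using assms by (simp add: path_of_def path_vertex_def Let_def)
qed

lemma path_of_odd:
  assumes "2 \<le> j" "j \<le> s"
  shows "path_of p k s l u (2 * (k + j) - 1) =
    (hook_x p k (2 * j - 1), hook_x p k (j - 1) + int (path_L' p k s l u j))"
proof -
  have "(2 * (k + j) - 1 + 1) div 2 - k = j" "2 * (k + j) - 1 \<noteq> 2 * k + 1"
    "odd (2 * (k + j) - 1)" "2 * (k + j) - 1 \<in> {2 * k + 1..2 * (k + s)}"
    using assms by auto
  then show ?thesis
    using assms unfolding path_of_def path_vertex_def Let_def restrict_apply by simp
qed

lemma path_of_bottom:
  assumes "1 \<le> s"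
  shows "path_of p k s l u (2 * k + 1) =
    (int p ^ k * (int p - 1), int (path_L p k s l u 1) + int p ^ k * int (u 1))"
  using assms by (simp add: path_of_def path_vertex_def Let_def)

lemma path_of_top:
  assumes "1 \<le> s"
  shows "path_of p k s l u (2 * (k + s)) = (hook_x p k (2 * s), hook_x p k s + int l)"
  using path_of_even[of s s] assms by simp

lemma blocks_odd:
  assumes "2 \<le> j" "j \<le> s"
  shows "block_h (path_of p k s l u) (2 * (k + j) - 1) = int p ^ k * int (u j)"
    and "block_v (path_of p k s l u) (2 * (k + j) - 1) = int p ^ k * (int p - 1 - int (u j))"
proof -
  have i: "2 * (k + j) - 1 + 1 = 2 * (k + j)"
    using assms by auto
  have e: "path_of p k s l u (2 * (k + j)) =
      (hook_x p k (2 * j), hook_x p k j + int (path_L p k s l u j))"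
    using assms by (intro path_of_even) auto
  show "block_h (path_of p k s l u) (2 * (k + j) - 1) = int p ^ k * int (u j)"
    using assms
    by (simp only: block_h_def i e path_of_odd[OF assms])
      (simp add: hook_x_def path_L'_def of_nat_diff algebra_simps)
  show "block_v (path_of p k s l u) (2 * (k + j) - 1) = int p ^ k * (int p - 1 - int (u j))"
    using assms
    by (simp only: block_v_def i e path_of_odd[OF assms])
      (simp add: hook_x_def path_L'_def of_nat_diff algebra_simps)
qed

lemma blocks_even:
  assumes "2 \<le> j" "j \<le> s"
  shows "block_v (path_of p k s l u) (2 * (k + j) - 2) =
      int (path_L' p k s l u j) - int (path_L' p k s l u j div p)"
    and "block_h (path_of p k s l u) (2 * (k + j) - 2) =
      int p ^ k * (int p - 1) - block_v (path_of p k s l u) (2 * (k + j) - 2)"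
proof -
  have i: "2 * (k + j) - 2 + 1 = 2 * (k + j) - 1" "2 * (k + j) - 2 = 2 * (k + (j - 1))"
    using assms by auto
  have e: "path_of p k s l u (2 * (k + j) - 2) = (hook_x p k (2 * (j - 1)),
      hook_x p k (j - 1) + int (path_L' p k s l u j div p))"
    unfolding i(2) path_L_step[OF assms, symmetric] using assms by (intro path_of_even) auto
  show v: "block_v (path_of p k s l u) (2 * (k + j) - 2) =
      int (path_L' p k s l u j) - int (path_L' p k s l u j div p)"
    by (simp only: block_v_def i(1) e path_of_odd[OF assms]) simp
  have "hook_x p k (2 * j - 1) - hook_x p k (2 * (j - 1)) = int p ^ k * (int p - 1)"
    using assms by (simp add: hook_x_def of_nat_diff algebra_simps)
  then show "block_h (path_of p k s l u) (2 * (k + j) - 2) =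
      int p ^ k * (int p - 1) - block_v (path_of p k s l u) (2 * (k + j) - 2)"
    by (simp only: block_h_def block_v_def i(1) e path_of_odd[OF assms]) simp
qed

lemma
  assumes "1 \<le> s"
  shows block_h_bottom:
      "block_h (path_of p k s l u) (2 * k + 1) = int p ^ k * int (u 1)"
    and block_v_bottom:
      "block_v (path_of p k s l u) (2 * k + 1) = int p ^ k * (int p - 2 - int (u 1))"
proof -
  have i: "2 * k + 1 + 1 = 2 * (k + 1)"
    by simp
  have e: "path_of p k s l u (2 * (k + 1)) =
      (hook_x p k (2 * 1), hook_x p k 1 + int (path_L p k s l u 1))"
    using assms by (intro path_of_even) auto
  show "block_h (path_of p k s l u) (2 * k + 1) = int p ^ k * int (u 1)"
    by (simp only: block_h_def i e path_of_bottom[OF assms])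
      (simp add: hook_x_def algebra_simps)
  show "block_v (path_of p k s l u) (2 * k + 1) = int p ^ k * (int p - 2 - int (u 1))"
    by (simp only: block_v_def i e path_of_bottom[OF assms])
      (simp add: hook_x_def algebra_simps)
qed

lemma inj_on_path_of:
  assumes "p > 0" "1 \<le> s"
  shows "inj_on (path_of p k s l) (path_choices p s)"
proof (rule inj_onI)
  fix u v
  assume u: "u \<in> path_choices p s" and v: "v \<in> path_choices p s"
    and eq: "path_of p k s l u = path_of p k s l v"
  have "u j = v j" if "j \<in> {1..s}" for j
  proof (cases "j = 1")
    case True
    then show ?thesis
      using block_h_bottom[OF assms(2), of p k l u] block_h_bottom[OF assms(2), of p k l v]
        eq assms(1) by simp
  next
    case False
    with that have "2 \<le> j" "j \<le> s"
      by auto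
    then show ?thesis
      using blocks_odd(1)[of j s p k l u] blocks_odd(1)[of j s p k l v] eq assms(1) by simp
  qed
  then show "u = v"
    using u v unfolding path_choices_def by (intro PiE_ext) auto
qed

end

theory Submission
  imports Defs
begin

text \<open>
  For \<open>k = 0\<close> and \<open>l = 0\<close> all \<open>L\<^sub>j\<close> vanish, since \<open>L'\<^sub>j = u\<^sub>j < p\<close>.  Hence a descent at an even block
  \<open>2j - 2\<close> means \<open>u\<^sub>j < (p - 1) / 2\<close>, and a descent at an odd block \<open>2j - 1\<close> means
  \<open>u\<^sub>j + u\<^sub>j\<^sub>+\<^sub>1 \<ge> p\<close>.  Exchanging the sums over paths and blocks, each block contributes
  a product of the number of admissible digits or pairs of digits with the number of free choices of
  the remaining digits.
\<close>

section \<open>Counting in finite product sets\<close>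

text \<open>A condition on one coordinate only shrinks that factor, so the restricted set is again a
  product.\<close>

lemma card_PiE_coord:
  assumes "finite I" "i \<in> I"
  shows "card {u \<in> Pi\<^sub>E I A. Q (u i)} = card {x \<in> A i. Q x} * (\<Prod>j\<in>I - {i}. card (A j))"
proof -
  have "{u \<in> Pi\<^sub>E I A. Q (u i)} = Pi\<^sub>E I (A(i := {x \<in> A i. Q x}))"
    using assms(2) by (auto simp: PiE_iff extensional_def split: if_splits)
  also have "card \<dots> = (\<Prod>j\<in>I. card ((A(i := {x \<in> A i. Q x})) j))"
    using assms(1) by (rule card_PiE)
  also have "\<dots> = card {x \<in> A i. Q x} * (\<Prod>j\<in>I - {i}. card ((A(i := {x \<in> A i. Q x})) j))"
    using assms by (simp add: prod.remove)
  also have "(\<Prod>j\<in>I - {i}. card ((A(i := {x \<in> A i. Q x})) j)) = (\<Prod>j\<in>I - {i}. card (A j))"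
    by (rule prod.cong) auto
  finally show ?thesis .
qed

text \<open>Slicing by the value \<open>x\<close> at \<open>i\<close> gives disjoint sets
  \<open>F x\<close>. Each slice is a product with the singleton factor \<open>{x}\<close> at
  \<open>i\<close> and a condition on \<open>j\<close> alone, so \<open>card_PiE_coord\<close>
  applies.\<close>

lemma card_PiE_coord_pair:
  assumes I: "finite I" "i \<in> I" "j \<in> I" "i \<noteq> j" and A: "\<And>n. n \<in> I \<Longrightarrow> finite (A n)"
  shows "card {u \<in> Pi\<^sub>E I A. R (u i) (u j)} =
    (\<Sum>x\<in>A i. card {y \<in> A j. R x y}) * (\<Prod>n\<in>I - {i, j}. card (A n))"
proof -
  define F where "F x = {u \<in> Pi\<^sub>E I (A(i := {x})). R x (u j)}" for x
  have fin: "finite (F x)" for x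
    proof -
    have "finite (Pi\<^sub>E I (A(i := {x})))"
      using I(1) A by (intro finite_PiE) auto
    then show ?thesis
      unfolding F_def by simp
  qed
  have card_F: "card (F x) = card {y \<in> A j. R x y} * (\<Prod>n\<in>I - {i, j}. card (A n))" for x
  proof -
    have "(\<Prod>n\<in>I - {j}. card ((A(i := {x})) n)) =
        card ((A(i := {x})) i) * (\<Prod>n\<in>I - {j} - {i}. card ((A(i := {x})) n))"
      using I by (intro prod.remove) auto
    also have "\<dots> = (\<Prod>n\<in>I - {j} - {i}. card (A n))"
      by simp
    also have "I - {j} - {i} = I - {i, j}"
      by auto
    finally show ?thesis
      unfolding F_def using card_PiE_coord[OF I(1,3), of "A(i := {x})" "R x"] I(4) by simp
  qed
  have "{u \<in> Pi\<^sub>E I A. R (u i) (u j)} = (\<Union>x\<in>A i. F x)"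
    unfolding F_def using I(2) by (auto simp: PiE_iff extensional_def split: if_splits)
  moreover have "card (\<Union>x\<in>A i. F x) = (\<Sum>x\<in>A i. card (F x))"
  proof (rule card_UN_disjoint)
    show "\<forall>x\<in>A i. \<forall>y\<in>A i. x \<noteq> y \<longrightarrow> F x \<inter> F y = {}"
      unfolding F_def using I(2) by (force simp: PiE_iff)
  qed (use A I fin in auto)
  ultimately show ?thesis
    by (simp add: card_F sum_distrib_right)
qed

section \<open>Blocks and descents for \<open>k = 0\<close>, \<open>l = 0\<close>\<close>

lemma path_choices_less:
  assumes "u \<in> path_choices p s" "1 \<le> j" "j \<le> s" "p \<ge> 2"
  shows "u j < p"
proof -
  have "u j \<in> (if j = 1 then {0..p - 2} else {0..p - 1})"
    using assms(1-3) unfolding path_choices_def by (auto dest: PiE_mem)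
  then show ?thesis
    using assms(4) by (auto split: if_splits)
qed

text \<open>From \<open>L = 0\<close> one step down yields \<open>u (s - d) div p\<close>, which
  vanishes because every digit is below \<open>p\<close>.\<close>

lemma path_L_zero:
  assumes "u \<in> path_choices p s" "p \<ge> 2"
  shows "path_L p 0 s 0 u j = 0"
proof -
  \<comment> \<open>The bound keeps the index \<open>s - d\<close> at least 1 in the induction step;
    \<open>s - j\<close> satisfies it for every \<open>j\<close>.\<close>
  have "path_L_down p 0 s 0 u d = 0" if "d \<le> s" for d
    using that
  proof (induction d)
    case (Suc d)
    then have "u (s - d) < p"
      using assms by (intro path_choices_less) auto
    then show ?case
      using Suc by simp
  qed simp
  then show ?thesis
    by (simp add: path_L_def)
qed

lemma blocks_even_zero:
  assumes "u \<in> path_choices p s" "p \<ge> 2" "2 \<le> j" "j \<le> s"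
  shows "block_v (path_of p 0 s 0 u) (2 * j - 2) = int (u j)"
    and "block_h (path_of p 0 s 0 u) (2 * j - 2) = int p - 1 - int (u j)"
proof -
  have "u j < p"
    using assms by (intro path_choices_less) auto
  then have "path_L' p 0 s 0 u j = u j" "path_L' p 0 s 0 u j div p = 0"
    using path_L_zero[OF assms(1,2)] by (simp_all add: path_L'_def)
  then show "block_v (path_of p 0 s 0 u) (2 * j - 2) = int (u j)"
    "block_h (path_of p 0 s 0 u) (2 * j - 2) = int p - 1 - int (u j)"
    using blocks_even[OF assms(3,4), of p 0 0 u] by simp_all
qed

text \<open>Block \<open>2 * j - 2\<close> has \<open>p - 1 - u j\<close> horizontal and
  \<open>u j\<close> vertical nodes, and block \<open>2 * j - 1\<close> has these swapped. As both
  have size \<open>p - 1\<close>, the two inequalities defining a descent are equivalent, and each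
  reduces to a single condition on digits.\<close>

lemma descents_zero:
  assumes u: "u \<in> path_choices p s" and p: "p \<ge> 2" and s: "1 \<le> s"
  shows "{i. has_descent p 0 s (path_of p 0 s 0 u) i} =
    (if 2 * u 1 + 1 < p then {0} else {}) \<union>
    (\<lambda>j. 2 * j - 2) ` {j \<in> {2..s}. 2 * u j + 1 < p} \<union>
    (\<lambda>j. 2 * j - 1) ` {j \<in> {2..<s}. p \<le> u j + u (j + 1)}"
    (is "?D = ?A \<union> ?B \<union> ?C")
proof -
  have zero: "0 \<in> ?D \<longleftrightarrow> 2 * u 1 + 1 < p"
    using block_h_bottom[OF s, of p 0 0 u] p by (auto simp: has_descent_def field_simps)
  have even: "2 * j - 2 \<in> ?D \<longleftrightarrow> 2 * u j + 1 < p" if "2 \<le> j" "j \<le> s" for j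
  proof -
    have "2 * j - 2 + 1 = 2 * j - 1"
      using that by simp
    then show ?thesis
      using blocks_even_zero[OF u p that] blocks_odd[OF that, of p 0 0 u] that
      by (auto simp: has_descent_def)
  qed
  have odd: "2 * j - 1 \<in> ?D \<longleftrightarrow> p \<le> u j + u (j + 1)" if "2 \<le> j" "j < s" for j
  proof -
    \<comment> \<open>The next block is the even one of index \<open>j + 1\<close>; this is where
      the digit \<open>u (j + 1)\<close> enters.\<close>
    have "2 * j - 1 + 1 = 2 * (j + 1) - 2" "2 \<le> j + 1" "j + 1 \<le> s" "2 \<le> 2 * j - 1"
      "2 * j - 1 \<le> 2 * s - 2"
      using that by simp_all
    then show ?thesis
      using blocks_even_zero[OF u p, of "j + 1"] blocks_odd[of j s p 0 0 u] that
      by (auto simp: has_descent_def simp del: One_nat_def)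
  qed
  have range: "i = 0 \<or> (\<exists>j. 2 \<le> j \<and> j \<le> s \<and> i = 2 * j - 2) \<or>
      (\<exists>j. 2 \<le> j \<and> j < s \<and> i = 2 * j - 1)" if "i \<in> ?D" for i
  proof -
    have "i = 0 \<or> 2 \<le> i \<and> i \<le> 2 * s - 2"
      using that by (auto simp: has_descent_def)
    then show ?thesis
      by presburger
  qed
  show ?thesis
  proof (intro equalityI subsetI)
    fix i assume i: "i \<in> ?D"
    from range[OF i] consider "i = 0" | j where "2 \<le> j" "j \<le> s" "i = 2 * j - 2"
      | j where "2 \<le> j" "j < s" "i = 2 * j - 1"
      by blast
    then show "i \<in> ?A \<union> ?B \<union> ?C"
    proof cases
      case 1
      then have "i \<in> ?A"
        using i zero by simp
      then show ?thesis
        by blast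
    next
      case (2 j)
      then have "i \<in> ?B"
        using i even[of j] by (intro image_eqI[of _ _ j]) auto
      then show ?thesis
        by blast
    next
      case (3 j)
      then have "i \<in> ?C"
        using i odd[of j] by (intro image_eqI[of _ _ j]) auto
      then show ?thesis
        by blast
    qed
  next
    fix i assume "i \<in> ?A \<union> ?B \<union> ?C"
    then show "i \<in> ?D"
      using zero even odd by (auto simp del: mem_Collect_eq split: if_splits)
  qed
qed

text \<open>The three families of descents sit at 0, at positive even and at odd positions, so they
  are disjoint. Indicator sums prepare the exchange of summations.\<close>

lemma des_zero:
  assumes "u \<in> path_choices p s" "p \<ge> 2" "1 \<le> s"
  shows "des p 0 s (path_of p 0 s 0 u) =
    of_bool (2 * u 1 + 1 < p) + (\<Sum>j\<in>{2..s}. of_bool (2 * u j + 1 < p)) +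
    (\<Sum>j\<in>{2..<s}. of_bool (p \<le> u j + u (j + 1)))"
proof -
  let ?A = "if 2 * u 1 + 1 < p then {0::nat} else {}"
  let ?B = "(\<lambda>j::nat. 2 * j - 2) ` {j \<in> {2..s}. 2 * u j + 1 < p}"
  let ?C = "(\<lambda>j::nat. 2 * j - 1) ` {j \<in> {2..<s}. p \<le> u j + u (j + 1)}"
  have "(?A \<union> ?B) \<inter> ?C = {}"
    by (auto split: if_splits) presburger+
  moreover have "?A \<inter> ?B = {}"
    by auto
  ultimately have "card (?A \<union> ?B \<union> ?C) = card ?A + card ?B + card ?C"
    by (simp add: card_Un_disjoint)
  moreover have "card ?B = card {j \<in> {2..s}. 2 * u j + 1 < p}"
    by (intro card_image inj_onI) auto
  moreover have "card ?C = card {j \<in> {2..<s}. p \<le> u j + u (j + 1)}"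
    by (intro card_image inj_onI) auto
  ultimately show ?thesis
    unfolding des_def descents_zero[OF assms]
    by (simp add: sum.If_cases of_bool_def Int_def)
qed

section \<open>Counting admissible digits and digit pairs\<close>

lemma sum_of_bool_card:
  "finite S \<Longrightarrow> (\<Sum>u\<in>S. of_bool (Q u)) = card {u \<in> S. Q u}"
  by (simp add: of_bool_def sum.If_cases Int_def)

text \<open>The bound \<open>m\<close> is left open to serve both \<open>u 1\<close>
  (\<open>m = p - 2\<close>) and the other digits (\<open>m = p - 1\<close>).\<close>

lemma card_lower_digits:
  assumes "p = 2 * q + 1" "m \<ge> q" 
  shows "card {x \<in> {0..m::nat}. 2 * x + 1 < p} = q"
proof -
  have "{x \<in> {0..m}. 2 * x + 1 < p} = {..<q}"
    using assms by auto
  then show ?thesis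
    by simp
qed

text \<open>For fixed \<open>x\<close> exactly the \<open>x\<close> largest digits \<open>y\<close>
  qualify, so the total is a Gauss sum.\<close>

lemma sum_card_carry_pairs:
  assumes "p = 2 * q + 1"
  shows "(\<Sum>x\<in>{0..p - 1}. card {y \<in> {0..p - 1}. p \<le> x + y}) = p * q"
proof -
  have "card {y \<in> {0..p - 1}. p \<le> x + y} = x" if "x \<in> {0..p - 1}" for x
  proof -
    have "{y \<in> {0..p - 1}. p \<le> x + y} = {p - x..<p}"
      using that assms by auto
    then show ?thesis
      using that assms by simp
  qed
  then have "(\<Sum>x\<in>{0..p - 1}. card {y \<in> {0..p - 1}. p \<le> x + y}) = \<Sum>{0..p - 1}"
    by simp
  also have "\<dots> = p * q"
    using assms by (simp add: gauss_sum_nat)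
  finally show ?thesis .
qed

text \<open>Since \<open>J\<close> avoids 1, the digit \<open>u 1\<close> stays free and gives the
  factor \<open>p - 1\<close>; all other free digits give \<open>p\<close>.\<close>

lemma prod_card_path_choices:
  assumes "p \<ge> 2" "J \<subseteq> {2..s}" "1 \<le> s"
  shows "(\<Prod>j\<in>{1..s} - J. card (if j = 1 then {0..p - 2} else {0..p - 1})) =
    (p - 1) * p ^ (s - 1 - card J)"
proof -
  have "{1..s} - J = insert 1 ({2..s} - J)"
    using assms by auto
  moreover have "(\<Prod>j\<in>{2..s} - J. card (if j = 1 then {0..p - 2} else {0..p - 1})) =
      (\<Prod>j\<in>{2..s} - J. p)"
    using assms(1) by (intro prod.cong) auto
  moreover have "card ({2..s} - J) = s - 1 - card J"
    using assms(2) by (simp add: card_Diff_subset finite_subset)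
  moreover have "card {0..p - 2} = p - 1"
    using assms(1) by simp
  ultimately show ?thesis
    by simp
qed

section \<open>Summation over all paths\<close>

text \<open>The summands belong to block 0, the even blocks and the odd blocks. Wherever
  \<open>s - 2\<close> or \<open>s - 3\<close> is truncated in an exponent, the coefficient in front
  is 0.\<close>

lemma fibonacci_number_zero:
  assumes p: "p = 2 * q + 1" "q \<ge> 1" and s: "1 \<le> s"
  shows "fibonacci_number p s 0 0 =
    q * p ^ (s - 1) + (s - 1) * (q * ((p - 1) * p ^ (s - 2))) +
    (s - 2) * (p * q * ((p - 1) * p ^ (s - 3)))"
proof -
  let ?P = "path_choices p s" and ?A = "\<lambda>j. if j = 1 then {0..p - 2} else {0..p - 1}"
  have p2: "p \<ge> 2"
    using p by simp
  have fin: "finite ?P"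
    unfolding path_choices_def by (intro finite_PiE) auto
  have first: "card {u \<in> ?P. 2 * u 1 + 1 < p} = q * p ^ (s - 1)"
  proof -
    \<comment> \<open>Here \<open>u 1\<close> itself is constrained, so the free digits give a pure
      power of \<open>p\<close>.\<close>
    have "(\<Prod>j\<in>{1..s} - {1}. card (?A j)) = (\<Prod>j\<in>{1..s} - {1}. p)"
      using p2 by (intro prod.cong) auto
    also have "\<dots> = p ^ (s - 1)"
      using s by simp
    finally show ?thesis
      unfolding path_choices_def
      using card_PiE_coord[of "{1..s}" 1 ?A "\<lambda>x. 2 * x + 1 < p"] s
        card_lower_digits[OF p(1), of "p - 2"] p by simp
  qed
  have single: "card {u \<in> ?P. 2 * u j + 1 < p} = q * ((p - 1) * p ^ (s - 2))"
    if "j \<in> {2..s}" for j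
    unfolding path_choices_def
    using card_PiE_coord[of "{1..s}" j ?A "\<lambda>x. 2 * x + 1 < p"] that s
      card_lower_digits[OF p(1), of "p - 1"] p
      prod_card_path_choices[OF p2, of "{j}" s] by (simp add: numeral_2_eq_2)
  have pair: "card {u \<in> ?P. p \<le> u j + u (j + 1)} = p * q * ((p - 1) * p ^ (s - 3))"
    if "j \<in> {2..<s}" for j
  proof -
    have "card {j, j + 1} = 2" "s - 1 - 2 = s - 3"
      by auto
    then have "(\<Prod>n\<in>{1..s} - {j, j + 1}. card (?A n)) = (p - 1) * p ^ (s - 3)"
      using prod_card_path_choices[OF p2, of "{j, j + 1}" s] that s by auto
    moreover have "(\<Sum>x\<in>?A j. card {y \<in> ?A (j + 1). p \<le> x + y}) = p * q"
      using sum_card_carry_pairs[OF p(1)] that by simp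
    moreover have "card {u \<in> ?P. p \<le> u j + u (j + 1)} =
        (\<Sum>x\<in>?A j. card {y \<in> ?A (j + 1). p \<le> x + y}) *
        (\<Prod>n\<in>{1..s} - {j, j + 1}. card (?A n))"
      unfolding path_choices_def
      by (rule card_PiE_coord_pair[where R = "\<lambda>x y. p \<le> x + y"]) (use that in auto)
    ultimately show ?thesis
      by simp
  qed
  have "fibonacci_number p s 0 0 = (\<Sum>u\<in>?P. des p 0 s (path_of p 0 s 0 u))"
    unfolding fibonacci_number_def paths_def
    using inj_on_path_of[of p s 0 0] p2 s by (simp add: sum.reindex)
  also have "\<dots> = (\<Sum>u\<in>?P. of_bool (2 * u 1 + 1 < p) +
      (\<Sum>j\<in>{2..s}. of_bool (2 * u j + 1 < p)) + (\<Sum>j\<in>{2..<s}. of_bool (p \<le> u j + u (j + 1))))"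
    using p2 s by (intro sum.cong des_zero) auto
  also have "\<dots> = (\<Sum>u\<in>?P. of_bool (2 * u 1 + 1 < p)) +
      (\<Sum>j\<in>{2..s}. \<Sum>u\<in>?P. of_bool (2 * u j + 1 < p)) +
      (\<Sum>j\<in>{2..<s}. \<Sum>u\<in>?P. of_bool (p \<le> u j + u (j + 1)))"
    by (simp only: sum.distrib sum.swap[of _ _ ?P])
  also have "\<dots> = q * p ^ (s - 1) + (\<Sum>j\<in>{2..s}. q * ((p - 1) * p ^ (s - 2))) +
      (\<Sum>j\<in>{2..<s}. p * q * ((p - 1) * p ^ (s - 3)))"
    by (simp only: sum_of_bool_card[OF fin] first single pair cong: sum.cong)
  finally show ?thesis
    by simp
qed

theorem theorem22:
  fixes p :: nat
  assumes "prime p" and "odd p"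
  shows "real (fibonacci_number p 1 0 0) = (real p - 1) / 2 \<and>
    (\<forall>s::nat. s \<ge> 2 \<longrightarrow>
      real (fibonacci_number p s 0 0) =
        (real p - 1) / 2 *
          (2 * (real s - 1) * real p ^ (s - 1) - (2 * real s - 3) * real p ^ (s - 2)))"
proof -
  obtain q where q: "p = 2 * q + 1"
    using assms(2) by (auto elim: oddE)
  have "q \<ge> 1"
    using q prime_gt_1_nat[OF assms(1)] by simp
  note fib = fibonacci_number_zero[OF q this]
  have "real (fibonacci_number p s 0 0) =
        (real p - 1) / 2 *
          (2 * (real s - 1) * real p ^ (s - 1) - (2 * real s - 3) * real p ^ (s - 2))"
    if "s \<ge> 2" for s
  proof -
    define t where "t = s - 2"
    then have t: "s = t + 2"
      using that by simp
    have pred: "p - Suc 0 = 2 * q"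
      using q by simp
    \<comment> \<open>For \<open>t > 0\<close> the factor \<open>p\<close> of the carry pairs raises
      \<open>p ^ (t - 1)\<close> to \<open>p ^ t\<close>; for \<open>t = 0\<close> the last summand
      is 0.\<close>
    have "fibonacci_number p s 0 0 =
        q * p ^ (t + 1) + (t + 1) * (q * (2 * q * p ^ t)) + t * (q * (2 * q * p ^ t))"
      using fib[of s] by (cases t) (simp_all add: t pred algebra_simps)
    then have "real (fibonacci_number p s 0 0) =
        real (q * p ^ (t + 1) + (t + 1) * (q * (2 * q * p ^ t)) + t * (q * (2 * q * p ^ t)))"
      by (rule arg_cong)
    also have "\<dots> = real q * real p ^ t * (real p + (2 * real t + 1) * (2 * real q))"
      by (simp add: algebra_simps)
    \<comment> \<open>The bracket becomes
      \<open>p + (2 * t + 1) * (p - 1) = 2 * (t + 1) * p - (2 * t + 1)\<close>, with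
      \<open>t + 1 = s - 1\<close> and \<open>2 * t + 1 = 2 * s - 3\<close>.\<close>
    also have "real q = (real p - 1) / 2"
      using q by simp
    finally show ?thesis
      by (simp add: t algebra_simps add_divide_distrib diff_divide_distrib)
  qed
  then show ?thesis
    using fib[of 1] q by simp
qed

end
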